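(* Let $\mathcal{A}$ be a $C^*$-algebra with unit $1$, let $n\ge2$, and let $(P_1,\dots,P_n)$ and $(P_1',\dots,P_n')$ be in $\mathbf{PC}_n(\mathcal{A})$. Then the following statements are equivalent: (1) $(P_1,\dots,P_n)\sim(P_1',\dots,P_n')$. (2) There is $D\in GL(\mathcal{A})$ such that for $1\le i\le n$, $P_iDD^*P_i=P_i$ and $P_i'=D^*P_iD$. (3) There is $(S_1,\dots,S_n)\in\mathbf{PC}_n(\mathcal{A})$ such that $(P_1,\dots,P_n)\sim_u(S_1,\dots,S_n)\sim_h(P_1',\dots,P_n')$.
   Context: A projection in $\mathcal{A}$ is an element $P$ with $P=P^*=P^2$; it is non-trivial if $P\ne0$ and $P\ne1$. $\mathbf{PC}_n(\mathcal{A})$ is the set of complete $n$-tuples, i.e. $n$-tuples $(P_1,\dots,P_n)$ of non-trivial projections in $\mathcal{A}$ such that $\mathcal{A}$ is the linear (algebraic) direct sum of the subspaces $P_i\mathcal{A}=\{P_ix:x\in\mathcal{A}\}$, $i=1,\dots,n$; it carries the topology induced by the norm (as a subset of $\mathcal{A}^n$). $GL(\mathcal{A})$ and $U(\mathcal{A})$ are the groups of invertible and unitary elements of $\mathcal{A}$. For $(P_1,\dots,P_n),(P_1',\dots,P_n')\in\mathbf{PC}_n(\mathcal{A})$: - $(P_1,\dots,P_n)\sim(P_1',\dots,P_n')$ means there are $U_1,\dots,U_n\in\mathcal{A}$ with $P_i=U_i^*U_i$ and $P_i'=U_iU_i^*$, $i=1,\dots,n$. - $(P_1,\dots,P_n)\sim_u(P_1',\dots,P_n')$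 means there is $U\in U(\mathcal{A})$ with $UP_iU^*=P_i'$, $i=1,\dots,n$. - $(P_1,\dots,P_n)\sim_h(P_1',\dots,P_n')$ means there is a continuous map $F:[0,1]\to\mathbf{PC}_n(\mathcal{A})$ with $F(0)=(P_1,\dots,P_n)$ and $F(1)=(P_1',\dots,P_n')$. *)

theory Defs
  imports "HOL-Analysis.Analysis"
begin

text \<open>
  Complex unital \<open>C\<^sup>*\<close>-algebras. The superclasses supply a real Banach algebra whose unit has norm
  one, so the zero algebra is excluded; it has no non-trivial projections.
\<close>

class cstar_algebra = real_normed_algebra_1 + banach +
  fixes scaleC :: "complex \<Rightarrow> 'a \<Rightarrow> 'a"  (infixr "*\<^sub>C" 75)
    and star :: "'a \<Rightarrow> 'a"  ("_\<^sup>\<star>" [1000] 999)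
  assumes scaleR_scaleC: "r *\<^sub>R x = complex_of_real r *\<^sub>C x"
    and scaleC_add_right: "c *\<^sub>C (x + y) = c *\<^sub>C x + c *\<^sub>C y"
    and scaleC_add_left: "(c + d) *\<^sub>C x = c *\<^sub>C x + d *\<^sub>C x"
    and scaleC_scaleC: "c *\<^sub>C (d *\<^sub>C x) = (c * d) *\<^sub>C x"
    and mult_scaleC_left: "(c *\<^sub>C x) * y = c *\<^sub>C (x * y)"
    and mult_scaleC_right: "x * (c *\<^sub>C y) = c *\<^sub>C (x * y)"
    and norm_scaleC: "norm (c *\<^sub>C x) = cmod c * norm x"
    and star_star: "(x\<^sup>\<star>)\<^sup>\<star> = x"
    and star_add: "(x + y)\<^sup>\<star> = x\<^sup>\<star> + y\<^sup>\<star>"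
    and star_scaleC: "(c *\<^sub>C x)\<^sup>\<star> = cnj c *\<^sub>C x\<^sup>\<star>"
    and star_mult: "(x * y)\<^sup>\<star> = y\<^sup>\<star> * x\<^sup>\<star>"
    and cstar_identity: "norm (x\<^sup>\<star> * x) = (norm x)\<^sup>2"

definition is_projection :: "'a::cstar_algebra \<Rightarrow> bool" where
  "is_projection p \<longleftrightarrow> p = p\<^sup>\<star> \<and> p = p ^ 2"

definition nontrivial_projection :: "'a::cstar_algebra \<Rightarrow> bool" where
  "nontrivial_projection p \<longleftrightarrow> is_projection p \<and> p \<noteq> 0 \<and> p \<noteq> 1"

definition GL :: "'a::cstar_algebra set" where
  "GL = {x. \<exists>y. x * y = 1 \<and> y * x = 1}"

definition unitary_group :: "'a::cstar_algebra set" where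
  "unitary_group = {u. u\<^sup>\<star> * u = 1 \<and> u * u\<^sup>\<star> = 1}"

text \<open>
  The whole space is the algebraic direct sum of the sets \<open>V i\<close> (intended to be subspaces):
  every vector is in exactly one way a sum of components in the \<open>V i\<close>.
\<close>

definition is_direct_sum :: "('n::finite \<Rightarrow> 'a::real_vector set) \<Rightarrow> bool" where
  "is_direct_sum V \<longleftrightarrow>
     (\<forall>x. \<exists>!y :: 'a ^ 'n. (\<forall>i. y $ i \<in> V i) \<and> x = (\<Sum>i\<in>UNIV. y $ i))"

text \<open>
  An \<open>n\<close>-tuple over the algebra is an element of \<open>'a ^ 'n\<close> with \<open>n = CARD('n)\<close>; its library topology
  is that of the norm.
\<close>

definition PC :: "('a::cstar_algebra ^ 'n::finite) set" where
  "PC = {P. (\<forall>i. nontrivial_projection (P $ i)) \<and> is_direct_sum (\<lambda>i. {P $ i * x | x. True})}"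

definition tuple_equiv :: "'a::cstar_algebra ^ 'n::finite \<Rightarrow> 'a ^ 'n \<Rightarrow> bool"  (infix "\<sim>\<^sub>M" 50) where
  "P \<sim>\<^sub>M P' \<longleftrightarrow> (\<exists>U :: 'a ^ 'n. \<forall>i. P $ i = (U $ i)\<^sup>\<star> * U $ i \<and> P' $ i = U $ i * (U $ i)\<^sup>\<star>)"

definition tuple_unitary_equiv :: "'a::cstar_algebra ^ 'n::finite \<Rightarrow> 'a ^ 'n \<Rightarrow> bool"
    (infix "\<sim>\<^sub>u" 50) where
  "P \<sim>\<^sub>u P' \<longleftrightarrow> (\<exists>U \<in> unitary_group. \<forall>i. U * P $ i * U\<^sup>\<star> = P' $ i)"

definition tuple_homotopic :: "'a::cstar_algebra ^ 'n::finite \<Rightarrow> 'a ^ 'n \<Rightarrow> bool"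
    (infix "\<sim>\<^sub>h" 50) where
  "P \<sim>\<^sub>h P' \<longleftrightarrow>
     (\<exists>F :: real \<Rightarrow> 'a ^ 'n. continuous_on {0..1} F \<and> F ` {0..1} \<subseteq> PC \<and> F 0 = P \<and> F 1 = P')"

end

theory Submission
  imports Defs
begin

text \<open>
  Completeness of \<open>P\<close> provides idempotents \<open>e\<^sub>i\<close> with sum \<open>1\<close>, \<open>P\<^sub>i e\<^sub>i = e\<^sub>i\<close> and \<open>e\<^sub>i P\<^sub>j = \<delta>\<^sub>i\<^sub>j P\<^sub>j\<close>; hence
  \<open>A = \<Sum> P\<^sub>i\<close> is invertible with inverse \<open>G = \<Sum> e\<^sub>i\<^sup>\<star> e\<^sub>i\<close>, and \<open>P\<^sub>i G P\<^sub>j = \<delta>\<^sub>i\<^sub>j P\<^sub>i\<close>. If partial isometries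
  \<open>U\<^sub>i\<close> implement (1), then \<open>D = G \<Sum> U\<^sub>i\<^sup>\<star>\<close> satisfies \<open>P\<^sub>i D = U\<^sub>i\<^sup>\<star>\<close>, which gives (2); conversely
  \<open>U\<^sub>i = D\<^sup>\<star> P\<^sub>i\<close>. For (3), every complete tuple is homotopic to the orthogonal tuple with entries
  \<open>A^(-1/2) P\<^sub>i A^(-1/2)\<close>, and equivalent orthogonal tuples with sum \<open>1\<close> are conjugate under the unitary
  \<open>\<Sum> U\<^sub>i\<close>. Finally, projections at distance less than \<open>1\<close> are equivalent, so equivalence is locally
  constant along a homotopy.
\<close>

section \<open>Elementary \<open>C\<^sup>*\<close>-algebra\<close>

lemma star_scaleR: "(r *\<^sub>R x)\<^sup>\<star> = r *\<^sub>R x\<^sup>\<star>" for x :: "'a::cstar_algebra"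
  by (simp add: scaleR_scaleC star_scaleC)

lemma star_zero [simp]: "(0 :: 'a::cstar_algebra)\<^sup>\<star> = 0"
  using star_add[of "0 :: 'a" 0] by simp

lemma star_one [simp]: "(1 :: 'a::cstar_algebra)\<^sup>\<star> = 1"
  by (metis mult.right_neutral mult_1 star_mult star_star)

lemma star_minus: "(- x)\<^sup>\<star> = - x\<^sup>\<star>" for x :: "'a::cstar_algebra"
  using star_scaleR[of "-1" x] by simp

lemma star_diff: "(x - y)\<^sup>\<star> = x\<^sup>\<star> - y\<^sup>\<star>" for x y :: "'a::cstar_algebra"
  using star_add[of x "- y"] by (simp add: star_minus)

lemma star_sum: "(\<Sum>i\<in>I. f i)\<^sup>\<star> = (\<Sum>i\<in>I. (f i)\<^sup>\<star>)" for f :: "'i \<Rightarrow> 'a::cstar_algebra"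
  by (induction I rule: infinite_finite_induct) (simp_all add: star_add)

lemma star_power: "(x ^ k)\<^sup>\<star> = (x\<^sup>\<star>) ^ k" for x :: "'a::cstar_algebra"
  by (induction k) (simp_all add: star_mult power_commutes)

text \<open>The C*-identity and submultiplicativity bound each norm by that of the adjoint; since
  the adjoint is an involution, the bound works both ways.\<close>

lemma norm_star: "norm (x\<^sup>\<star>) = norm x" for x :: "'a::cstar_algebra"
proof -
  have le: "norm y \<le> norm (y\<^sup>\<star>)" for y :: 'a
  proof (cases "y = 0")
    case False
    have "norm y * norm y \<le> norm (y\<^sup>\<star>) * norm y"
      using norm_mult_ineq[of "y\<^sup>\<star>" y] by (simp add: cstar_identity power2_eq_square)
    then show ?thesis using False by simp
  qed simp
  show ?thesis using le[of x] le[of "x\<^sup>\<star>"] by (simp add: star_star)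
qed

lemma bounded_linear_star: "bounded_linear (star :: 'a::cstar_algebra \<Rightarrow> 'a)"
  by (rule bounded_linear_intro[where K = 1]) (simp_all add: star_add star_scaleR norm_star)

lemma projection_star: "is_projection p \<Longrightarrow> p\<^sup>\<star> = p"
  by (simp add: is_projection_def)

lemma projection_mult: "is_projection p \<Longrightarrow> p * p = p"
  by (simp add: is_projection_def power2_eq_square)

lemma projection_mult_left: "is_projection p \<Longrightarrow> p * (p * x) = p * x"
  by (metis mult.assoc projection_mult)

lemma is_projectionI: "p\<^sup>\<star> = p \<Longrightarrow> p * p = p \<Longrightarrow> is_projection p"
  by (simp add: is_projection_def power2_eq_square)

lemma norm_projection_le: "is_projection p \<Longrightarrow> norm p \<le> 1"
  using cstar_identity[of p]
  by (cases "p = 0") (simp_all add: projection_star projection_mult power2_eq_square)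

lemma projection_complement: "is_projection p \<Longrightarrow> is_projection (1 - p)"
  by (intro is_projectionI) (simp_all add: star_diff projection_star projection_mult algebra_simps)

lemma neumann_inverse:
  fixes y :: "'a::{real_normed_algebra_1, banach}"
  assumes "norm y < 1"
  obtains g where "(1 - y) * g = 1" "g * (1 - y) = 1"
proof
  have sm: "summable (\<lambda>n. y ^ n)"
    using assms by (rule complete_algebra_summable_geometric)
  have split: "(\<Sum>n. y ^ n) = 1 + (\<Sum>n. y ^ Suc n)"
    using suminf_split_head[OF sm] by simp
  show "(1 - y) * (\<Sum>n. y ^ n) = 1"
    using suminf_mult[OF sm, of y] split by (simp add: algebra_simps)
  show "(\<Sum>n. y ^ n) * (1 - y) = 1"
    using suminf_mult2[OF sm, of y] split by (simp add: algebra_simps power_commutes)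
qed

section \<open>The binomial series for the square root\<close>

text \<open>Taylor coefficients of sqrt (1 - x), that is, (-1)^n times the binomial coefficient of
  1/2 over n.\<close>

definition sqrt_coeff :: "nat \<Rightarrow> real" where
  "sqrt_coeff n = pochhammer (- 1 / 2) n / fact n"

lemma sqrt_coeff_nonpos: "sqrt_coeff (Suc n) \<le> 0"
  using pochhammer_nonneg[of "1/2 :: real" n]
  by (simp add: sqrt_coeff_def pochhammer_rec divide_nonpos_pos)

text \<open>Partial sums of a series are the coefficients of its quotient by 1 - x, here of (1 -
  x)^(-1/2). What matters below is that they are nonnegative.\<close>

lemma sum_sqrt_coeff: "(\<Sum>k\<le>n. sqrt_coeff k) = pochhammer (1 / 2) n / fact n"
proof (induction n)
  case (Suc n)
  have "sqrt_coeff (Suc n) = - pochhammer (1 / 2) n / (2 * fact (Suc n))"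
    by (simp add: sqrt_coeff_def pochhammer_rec)
  then show ?case
    unfolding sum.atMost_Suc Suc.IH by (simp add: pochhammer_Suc divide_simps) (simp add: algebra_simps)
qed (simp add: sqrt_coeff_def)

text \<open>All coefficients after the leading 1 are nonpositive while the partial sums stay
  nonnegative, so the absolute values after the first add up to at most 1. This gives absolute
  convergence up to the boundary of the unit ball.\<close>

lemma summable_abs_sqrt_coeff: "summable (\<lambda>n. \<bar>sqrt_coeff n\<bar>)"
proof -
  have "(\<Sum>i<n. \<bar>sqrt_coeff (Suc i)\<bar>) \<le> 1" for n
  proof -
    have "(\<Sum>k\<le>n. sqrt_coeff k) = 1 + (\<Sum>i<n. sqrt_coeff (Suc i))"
      by (simp add: sum.atMost_shift sqrt_coeff_def)
    moreover have "(\<Sum>k\<le>n. sqrt_coeff k) \<ge> 0"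
      by (simp add: sum_sqrt_coeff pochhammer_nonneg)
    moreover have "(\<Sum>i<n. \<bar>sqrt_coeff (Suc i)\<bar>) = - (\<Sum>i<n. sqrt_coeff (Suc i))"
      by (simp add: sqrt_coeff_nonpos sum_negf)
    ultimately show ?thesis by simp
  qed
  then have "summable (\<lambda>n. \<bar>sqrt_coeff (Suc n)\<bar>)"
    by (intro summableI_nonneg_bounded) auto
  then show ?thesis by (rule iffD1[OF summable_Suc_iff])
qed

text \<open>The Vandermonde identity for rising factorials with both parameters -1/2 yields the
  coefficients of 1 - x, since the rising factorial of -1 vanishes from n = 2 on.\<close>

lemma sqrt_coeff_convolution:
  "(\<Sum>i\<le>n. sqrt_coeff i * sqrt_coeff (n - i)) = (if n = 0 then 1 else if n = 1 then - 1 else 0)"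
proof -
  have "(\<Sum>i\<le>n. sqrt_coeff i * sqrt_coeff (n - i)) = pochhammer (- 1) n / fact n"
    unfolding pochhammer_binomial_sum[of "- 1/2" "- 1/2 :: real" n, simplified] sum_divide_distrib
    by (intro sum.cong) (auto simp: sqrt_coeff_def binomial_fact field_simps)
  moreover have "pochhammer (- 1 :: real) n = (if n = 0 then 1 else if n = 1 then - 1 else 0)"
    using pochhammer_of_nat_eq_0_lemma[of 1 n, where 'a = real] by (auto simp: not_less)
  ultimately show ?thesis by simp
qed

definition sqrt_one_minus :: "'a::{real_normed_algebra_1, banach} \<Rightarrow> 'a" where
  "sqrt_one_minus y = (\<Sum>n. sqrt_coeff n *\<^sub>R y ^ n)"

lemma norm_sqrt_term_le:
  fixes y :: "'a::real_normed_algebra_1"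
  assumes "norm y \<le> 1"
  shows "norm (sqrt_coeff n *\<^sub>R y ^ n) \<le> \<bar>sqrt_coeff n\<bar>"
proof -
  have "norm (y ^ n) \<le> 1"
    using norm_power_ineq[of y n] power_le_one[of "norm y" n] assms by simp
  then show ?thesis by (simp add: mult_left_le)
qed

lemma summable_norm_sqrt_series:
  fixes y :: "'a::real_normed_algebra_1"
  assumes "norm y \<le> 1"
  shows "summable (\<lambda>n. norm (sqrt_coeff n *\<^sub>R y ^ n))"
  by (rule summable_comparison_test'[OF summable_abs_sqrt_coeff])
     (simp only: real_norm_def abs_norm_cancel norm_sqrt_term_le[OF assms])

lemma summable_sqrt_series:
  fixes y :: "'a::{real_normed_algebra_1, banach}"
  assumes "norm y \<le> 1"
  shows "summable (\<lambda>n. sqrt_coeff n *\<^sub>R y ^ n)"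
  using summable_norm_sqrt_series[OF assms] by (rule summable_norm_cancel)

lemma sqrt_one_minus_square:
  fixes y :: "'a::{real_normed_algebra_1, banach}"
  assumes "norm y \<le> 1"
  shows "sqrt_one_minus y * sqrt_one_minus y = 1 - y"
proof -
  let ?c = "\<lambda>n. if n = 0 then 1 else if n = 1 then - y else 0"
  have "(\<Sum>i\<le>n. (sqrt_coeff i *\<^sub>R y ^ i) * (sqrt_coeff (n - i) *\<^sub>R y ^ (n - i))) = ?c n" for n
  proof -
    have "(\<Sum>i\<le>n. (sqrt_coeff i *\<^sub>R y ^ i) * (sqrt_coeff (n - i) *\<^sub>R y ^ (n - i)))
        = (\<Sum>i\<le>n. (sqrt_coeff i * sqrt_coeff (n - i)) *\<^sub>R y ^ n)"
      by (intro sum.cong refl) (simp flip: power_add)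
    then show ?thesis
      by (simp only: sqrt_coeff_convolution flip: scaleR_sum_left) simp
  qed
  then have "?c sums (sqrt_one_minus y * sqrt_one_minus y)"
    using Cauchy_product_sums[OF summable_norm_sqrt_series[OF assms] summable_norm_sqrt_series[OF assms]]
    by (simp add: sqrt_one_minus_def)
  moreover have "?c sums (\<Sum>n\<in>{0, 1 :: nat}. ?c n)"
    by (rule sums_finite) auto
  ultimately show ?thesis by (simp add: sums_iff)
qed

lemma sqrt_one_minus_commute:
  fixes y z :: "'a::{real_normed_algebra_1, banach}"
  assumes "norm y \<le> 1" "z * y = y * z"
  shows "z * sqrt_one_minus y = sqrt_one_minus y * z"
  using suminf_mult[OF summable_sqrt_series[OF assms(1)], of z]
    suminf_mult2[OF summable_sqrt_series[OF assms(1)], of z]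
    power_commuting_commutes[OF assms(2)[symmetric]]
  by (simp add: sqrt_one_minus_def)

lemma star_sqrt_one_minus:
  fixes y :: "'a::cstar_algebra"
  assumes "norm y \<le> 1"
  shows "(sqrt_one_minus y)\<^sup>\<star> = sqrt_one_minus (y\<^sup>\<star>)"
  using bounded_linear.suminf[OF bounded_linear_star summable_sqrt_series[OF assms]]
  by (simp add: sqrt_one_minus_def star_scaleR star_power)

text \<open>The coefficients themselves form a summable majorant, so convergence is uniform on the
  closed ball. The boundary is included because the path used later may start there.\<close>

lemma continuous_on_sqrt_one_minus:
  "continuous_on (cball 0 1) (sqrt_one_minus :: 'a::{real_normed_algebra_1, banach} \<Rightarrow> 'a)"
proof -
  have "uniform_limit (cball 0 1) (\<lambda>n (y :: 'a). \<Sum>i<n. sqrt_coeff i *\<^sub>R y ^ i)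
      (\<lambda>y. \<Sum>i. sqrt_coeff i *\<^sub>R y ^ i) sequentially"
    by (rule Weierstrass_m_test[OF _ summable_abs_sqrt_coeff], rule norm_sqrt_term_le) simp
  then have "continuous_on (cball 0 1) (\<lambda>y :: 'a. \<Sum>i. sqrt_coeff i *\<^sub>R y ^ i)"
    by (rule uniform_limit_theorem[rotated]) (auto intro!: always_eventually continuous_intros)
  then show ?thesis by (simp add: sqrt_one_minus_def[abs_def])
qed

lemma inverse_commute:
  fixes x g z :: "'a::monoid_mult"
  assumes "x * g = 1" "g * x = 1" "z * x = x * z"
  shows "z * g = g * z"
  by (metis assms mult.assoc mult.left_neutral mult.right_neutral)

text \<open>The witness \<open>h\<close> is (1 - y)^(-1/2), formed as the square root of
  \<open>1 - y\<close> times its inverse \<open>g\<close>. Invertibility is a separate assumption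
  because \<open>norm y = 1\<close> is allowed.\<close>

lemma inverse_sqrt_one_minus:
  fixes y g :: "'a::cstar_algebra"
  assumes y: "norm y \<le> 1" "y\<^sup>\<star> = y" and g: "(1 - y) * g = 1" "g * (1 - y) = 1"
  obtains h where "h\<^sup>\<star> = h" "h * h = g" "sqrt_one_minus y * h = 1" "h * sqrt_one_minus y = 1"
    "\<And>z. z * y = y * z \<Longrightarrow> z * h = h * z"
proof
  let ?s = "sqrt_one_minus y"
  let ?h = "?s * g"
  have gc: "z * g = g * z" if "z * y = y * z" for z
    using g by (rule inverse_commute) (simp add: algebra_simps that)
  have sc: "z * ?s = ?s * z" if "z * y = y * z" for z
    using y(1) that by (rule sqrt_one_minus_commute)
  have sg: "?s * g = g * ?s"
    using sc[of y] gc[of ?s] by simp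
  have ss: "?s * ?s = 1 - y"
    using y(1) by (rule sqrt_one_minus_square)
  show "?s * ?h = 1" by (metis ss g(1) mult.assoc)
  show hs: "?h * ?s = 1" by (metis ss sg g(2) mult.assoc)
  show "?h * ?h = g" by (metis hs sg mult.assoc mult.left_neutral)
  show "z * ?h = ?h * z" if "z * y = y * z" for z
    using gc[OF that] sc[OF that] by (metis mult.assoc)
  \<comment> \<open>The adjoint of \<open>g\<close> is another right inverse of the self-adjoint
    \<open>1 - y\<close>, so it equals \<open>g\<close>.\<close>
  have "(1 - y) * g\<^sup>\<star> = 1"
    using g(2) y(2) by (metis star_diff star_mult star_one)
  then have "g\<^sup>\<star> = g"
    using g(2) by (metis mult.assoc mult.left_neutral mult.right_neutral)
  then show "?h\<^sup>\<star> = ?h"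
    using y sg by (simp add: star_mult star_sqrt_one_minus)
qed

section \<open>Murray--von Neumann equivalence\<close>

definition mvn_equiv :: "'a::cstar_algebra \<Rightarrow> 'a \<Rightarrow> bool" where
  "mvn_equiv p q \<longleftrightarrow> (\<exists>u. p = u\<^sup>\<star> * u \<and> q = u * u\<^sup>\<star>)"

lemma tuple_equiv_iff_mvn: "P \<sim>\<^sub>M P' \<longleftrightarrow> (\<forall>i. mvn_equiv (P $ i) (P' $ i))"
proof
  assume "\<forall>i. mvn_equiv (P $ i) (P' $ i)"
  then obtain u where "\<forall>i. P $ i = (u i)\<^sup>\<star> * u i \<and> P' $ i = u i * (u i)\<^sup>\<star>"
    unfolding mvn_equiv_def by metis
  then show "P \<sim>\<^sub>M P'"
    unfolding tuple_equiv_def by (intro exI[of _ "\<chi> i. u i"]) simp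
qed (auto simp: tuple_equiv_def mvn_equiv_def)

lemma mvn_equiv_sym: "mvn_equiv p q \<Longrightarrow> mvn_equiv q p"
  unfolding mvn_equiv_def by (metis star_star)

lemma mvn_equiv_trans:
  assumes "is_projection p" "is_projection r" "mvn_equiv p q" "mvn_equiv q r"
  shows "mvn_equiv p r"
proof -
  obtain u v where u: "p = u\<^sup>\<star> * u" "q = u * u\<^sup>\<star>" and v: "q = v\<^sup>\<star> * v" "r = v * v\<^sup>\<star>"
    using assms by (auto simp: mvn_equiv_def)
  have "(v * u)\<^sup>\<star> * (v * u) = u\<^sup>\<star> * q * u"
    using v(1) by (simp add: star_mult mult.assoc)
  also have "\<dots> = p * p"
    using u by (simp add: mult.assoc)
  finally have 1: "(v * u)\<^sup>\<star> * (v * u) = p"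
    by (simp add: projection_mult assms(1))
  have "(v * u) * (v * u)\<^sup>\<star> = v * q * v\<^sup>\<star>"
    using u(2) by (simp add: star_mult mult.assoc)
  also have "\<dots> = r * r"
    using v by (simp add: mult.assoc)
  finally have "(v * u) * (v * u)\<^sup>\<star> = r"
    by (simp add: projection_mult assms(2))
  with 1 show ?thesis
    unfolding mvn_equiv_def by metis
qed

lemma mvn_equiv_unitary_conj:
  assumes "is_projection p" "u \<in> unitary_group"
  shows "mvn_equiv p (u * p * u\<^sup>\<star>)"
proof -
  have "u\<^sup>\<star> * (u * x) = x" for x
    using assms(2) by (metis (mono_tags) unitary_group_def mem_Collect_eq mult.assoc mult.left_neutral)
  then show ?thesis
    unfolding mvn_equiv_def using assms(1)
    by (intro exI[of _ "u * p"])
       (simp add: star_mult projection_star projection_mult projection_mult_left mult.assoc)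
qed

text \<open>The partial isometry is the polar part \<open>qp (pqp)^(-1/2)\<close>, the inverse being taken in the corner
  \<open>p\<A>p\<close>; \<open>1 - y\<close> below is \<open>pqp + (1 - p)\<close>.\<close>
lemma mvn_equiv_close_projections:
  fixes p q :: "'a::cstar_algebra"
  assumes p: "is_projection p" and q: "is_projection q" and close: "norm (p - q) < 1"
  shows "mvn_equiv p q"
proof -
  note ps = projection_star[OF p] and qs = projection_star[OF q]
  note pp = projection_mult[OF p] projection_mult_left[OF p]
  note qq = projection_mult[OF q] projection_mult_left[OF q]
  define y where "y = p - p * q * p"
  have ys: "y\<^sup>\<star> = y"
    by (simp add: y_def star_diff star_mult ps qs mult.assoc)
  have py: "p * y = y * p"
    by (simp add: y_def algebra_simps pp)
  have "norm y = norm (p * (p - q) * p)"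
    by (simp add: y_def algebra_simps pp)
  also have "\<dots> \<le> norm p * norm (p - q) * norm p"
    by (meson norm_mult_ineq order_trans mult_right_mono norm_ge_zero)
  also have "\<dots> \<le> 1 * norm (p - q) * 1"
    using norm_projection_le[OF p] by (intro mult_mono) auto
  finally have y1: "norm y < 1"
    using close by simp
  obtain g where g: "(1 - y) * g = 1" "g * (1 - y) = 1"
    using y1 by (rule neumann_inverse)
  obtain h where h: "h\<^sup>\<star> = h" "h * h = g" "\<And>z. z * y = y * z \<Longrightarrow> z * h = h * z"
    using inverse_sqrt_one_minus[OF less_imp_le[OF y1] ys g] by metis
  have ph: "p * h = h * p"
    using h(3)[OF py] .
  have yp: "p * (q * p) = (1 - y) * p"
    by (simp add: y_def algebra_simps pp)
  let ?u = "q * p * h"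
  have us: "?u\<^sup>\<star> = h * (p * q)"
    using ps qs h(1) by (simp add: star_mult mult.assoc)
  have "?u\<^sup>\<star> * ?u = h * (p * (q * p)) * h"
    unfolding us by (simp add: qq mult.assoc)
  also have "\<dots> = h * (1 - y) * h * p"
    by (simp only: yp mult.assoc ph)
  also have "h * (1 - y) * h = 1"
    using h(3)[of "1 - y"] g(2) h(2) by (simp add: algebra_simps) (metis mult.assoc)
  finally have 1: "?u\<^sup>\<star> * ?u = p"
    by simp
  define r where "r = q * p * g * p * q"
  have "?u * ?u\<^sup>\<star> = r"
    unfolding us r_def by (simp add: mult.assoc flip: h(2))
  moreover have "r = q"
  proof (rule ccontr)
    assume "r \<noteq> q"
    have "r * p = q * p * (g * (1 - y)) * p"
      unfolding r_def by (simp only: mult.assoc yp)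
    then have rp: "r * p = q * p"
      by (simp add: g(2) mult.assoc pp)
    \<comment> \<open>From \<open>r * p = q * p\<close> and \<open>r * q = r\<close>, right
      multiplication by \<open>q - p\<close> fixes \<open>q - r\<close>; as
      \<open>norm (q - p) < 1\<close>, this forces \<open>q - r\<close> to vanish.\<close>
    have "q - r = (q - r) * (q - p)"
      by (simp add: algebra_simps rp qq) (simp add: r_def mult.assoc qq)
    then have "norm (q - r) \<le> norm (q - r) * norm (q - p)"
      by (metis norm_mult_ineq)
    moreover have "norm (q - r) * norm (q - p) < norm (q - r) * 1"
      using \<open>r \<noteq> q\<close> close by (intro mult_strict_left_mono) (auto simp: norm_minus_commute)
    ultimately show False by simp
  qed
  ultimately show ?thesis
    using 1 unfolding mvn_equiv_def by metis
qed

section \<open>Complete tuples\<close>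

text \<open>Left multiplication by \<open>e i\<close> is the (in general non-orthogonal) coordinate projection of the
  decomposition onto its \<open>i\<close>-th summand.\<close>
lemma is_direct_sum_right_ideals_iff:
  fixes P :: "'a::real_algebra_1 ^ 'n::finite"
  assumes idem: "\<And>i. P $ i * P $ i = P $ i"
  shows "is_direct_sum (\<lambda>i. {P $ i * x | x. True}) \<longleftrightarrow>
    (\<exists>e. (\<Sum>i\<in>UNIV. e i) = 1 \<and> (\<forall>i. P $ i * e i = e i) \<and>
         (\<forall>i j. e i * P $ j = (if i = j then P $ j else 0)))"
    (is "?D \<longleftrightarrow> (\<exists>e. ?E e)")
proof
  assume D: ?D
  \<comment> \<open>The components of the unit are the required \<open>e i\<close>.\<close>
  then obtain y :: "'a ^ 'n" where y: "\<And>i. \<exists>x. y $ i = P $ i * x" "(\<Sum>i\<in>UNIV. y $ i) = 1"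
    unfolding is_direct_sum_def mem_Collect_eq by metis
  have Py: "P $ i * y $ i = y $ i" for i
    using y(1)[of i] by (auto simp: idem simp flip: mult.assoc)
  have "y $ i * P $ j = (if i = j then P $ j else 0)" for i j
  proof -
    \<comment> \<open>Two decompositions of \<open>P $ j\<close>: the decomposition of 1 multiplied
      by \<open>P $ j\<close>, and the trivial one. Uniqueness identifies them.\<close>
    let ?v = "\<chi> i. y $ i * P $ j" and ?w = "\<chi> i. if i = j then P $ j else 0"
    have "?v = ?w"
    proof (rule ex1E[OF D[unfolded is_direct_sum_def, rule_format, of "P $ j"]])
      fix z :: "'a ^ 'n"
      assume uniq: "\<forall>z'. (\<forall>i. z' $ i \<in> {P $ i * x | x. True}) \<and> P $ j = (\<Sum>i\<in>UNIV. z' $ i) \<longrightarrow> z' = z"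
      have "(\<Sum>i\<in>UNIV. y $ i * P $ j) = P $ j"
        by (simp add: y(2) flip: sum_distrib_right)
      moreover have "\<exists>x. y $ i * P $ j = P $ i * x" for i
        by (intro exI[of _ "y $ i * P $ j"]) (simp add: Py flip: mult.assoc)
      ultimately have "?v = z"
        by (intro uniq[rule_format] conjI allI) simp_all
      moreover have "\<exists>x. (if i = j then P $ j else 0) = P $ i * x" for i
        by (cases "i = j") (auto intro: exI[of _ 0] exI[of _ "P $ j"] simp: idem)
      then have "?w = z"
        by (intro uniq[rule_format] conjI allI) simp_all
      ultimately show ?thesis by simp
    qed
    then show ?thesis by (simp add: vec_eq_iff)
  qed
  then show "\<exists>e. ?E e"
    using y(2) Py by (intro exI[of _ "\<lambda>i. y $ i"]) simp
next
  assume "\<exists>e. ?E e"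
  then obtain e where sum_e: "(\<Sum>i\<in>UNIV. e i) = 1" and Pe: "\<And>i. P $ i * e i = e i"
    and eP: "\<And>i j. e i * P $ j = (if i = j then P $ j else 0)"
    by blast
  show ?D
    unfolding is_direct_sum_def
  proof (intro allI ex1I[where a = "\<chi> i. e i * x" for x] conjI)
    fix x i
    show "(\<chi> i. e i * x) $ i \<in> {P $ i * x | x. True}"
      using Pe[of i] by (auto intro!: exI[of _ "e i * x"] simp flip: mult.assoc)
    show "x = (\<Sum>i\<in>UNIV. (\<chi> i. e i * x) $ i)"
      by (simp add: sum_e flip: sum_distrib_right)
  next
    fix x and z :: "'a ^ 'n"
    assume z: "(\<forall>i. z $ i \<in> {P $ i * x | x. True}) \<and> x = (\<Sum>i\<in>UNIV. z $ i)"
    have "e j * z $ i = (if j = i then z $ i else 0)" for i j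
    proof -
      obtain w where "z $ i = P $ i * w"
        using z by blast
      then show ?thesis by (simp add: eP flip: mult.assoc)
    qed
    then have "e j * x = z $ j" for j
      using z by (simp add: sum_distrib_left)
    then show "z = (\<chi> i. e i * x)"
      by (simp add: vec_eq_iff)
  qed
qed

lemma PC_iff:
  "P \<in> PC \<longleftrightarrow> (\<forall>i. nontrivial_projection (P $ i)) \<and>
    (\<exists>e. (\<Sum>i\<in>UNIV. e i) = 1 \<and> (\<forall>i. P $ i * e i = e i) \<and>
         (\<forall>i j. e i * P $ j = (if i = j then P $ j else 0)))"
  unfolding PC_def mem_Collect_eq
  by (intro conj_cong refl is_direct_sum_right_ideals_iff)
     (simp add: nontrivial_projection_def projection_mult)

lemma PC_projection: "P \<in> PC \<Longrightarrow> is_projection (P $ i)"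
  by (simp add: PC_def nontrivial_projection_def)

lemma PC_sum_inverse:
  assumes P: "P \<in> PC"
  obtains G where "G * (\<Sum>i\<in>UNIV. P $ i) = 1" "(\<Sum>i\<in>UNIV. P $ i) * G = 1"
    "\<And>i j. P $ i * (G * P $ j) = (if i = j then P $ i else 0)"
proof -
  let ?A = "\<Sum>i\<in>UNIV. P $ i"
  obtain e where sum_e: "(\<Sum>i\<in>UNIV. e i) = 1" and Pe: "\<And>i. P $ i * e i = e i"
    and eP: "\<And>i j. e i * P $ j = (if i = j then P $ j else 0)"
    using P unfolding PC_iff by metis
  have Ps: "(P $ i)\<^sup>\<star> = P $ i" for i
    using PC_projection[OF P] by (rule projection_star)
  have esP: "(e i)\<^sup>\<star> * P $ i = (e i)\<^sup>\<star>" for i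
    by (metis Pe Ps star_mult)
  define G where "G = (\<Sum>i\<in>UNIV. (e i)\<^sup>\<star> * e i)"
  \<comment> \<open>Only the term with index \<open>j\<close> survives. Summing over
    \<open>j\<close> gives the adjoint of the sum of the \<open>e j\<close>, which is 1; the right
    inverse follows by taking adjoints, as both factors are self-adjoint.\<close>
  have GP: "G * P $ j = (e j)\<^sup>\<star>" for j
    by (simp add: G_def sum_distrib_right mult.assoc eP esP if_distrib[of "(*) _"] cong: if_cong)
  have GA: "G * ?A = 1"
    by (simp add: sum_distrib_left GP sum_e flip: star_sum)
  have AG: "?A * G = 1"
  proof -
    have "(G * ?A)\<^sup>\<star> = ?A * G"
      by (simp add: G_def star_mult star_sum Ps star_star)
    then show ?thesis by (simp add: GA)
  qed
  have "P $ i * (G * P $ j) = (if i = j then P $ i else 0)" for i j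
    unfolding GP using arg_cong[OF eP[of j i], of star] by (auto simp: star_mult Ps split: if_splits)
  with GA AG show ?thesis by (rule that)
qed

text \<open>The idempotents of the new tuple are the conjugates of the \<open>e i\<close> by
  \<open>D\<close>. The compression condition is what makes each
  \<open>D * P $ i * D\<^sup>\<star>\<close> idempotent.\<close>

lemma PC_congruence:
  assumes P: "P \<in> PC" and D: "D \<in> GL" and PDP: "\<And>i. P $ i * D\<^sup>\<star> * D * P $ i = P $ i"
  shows "(\<chi> i. D * P $ i * D\<^sup>\<star>) \<in> PC"
proof -
  obtain e where sum_e: "(\<Sum>i\<in>UNIV. e i) = 1" and Pe: "\<And>i. P $ i * e i = e i"
    and eP: "\<And>i j. e i * P $ j = (if i = j then P $ j else 0)"
    and nontriv: "\<And>i. nontrivial_projection (P $ i)"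
    using P unfolding PC_iff by metis
  obtain E where E: "D * E = 1" "E * D = 1"
    using D by (auto simp: GL_def)
  have E': "E * (D * x) = x" "D\<^sup>\<star> * E\<^sup>\<star> = 1" for x
    using E by (metis mult.assoc mult_1) (metis E(2) star_mult star_one)
  have PDP': "P $ i * (D\<^sup>\<star> * (D * (P $ i * x))) = P $ i * x" for i x
    using PDP[of i] by (metis mult.assoc)
  have P1: "P $ i = E * (D * P $ i * D\<^sup>\<star>) * E\<^sup>\<star>" for i
    by (simp add: mult.assoc E')
  have "nontrivial_projection (D * P $ i * D\<^sup>\<star>)" for i
    unfolding nontrivial_projection_def
  proof (intro conjI)
    show "is_projection (D * P $ i * D\<^sup>\<star>)"
      using PC_projection[OF P, of i]
      by (intro is_projectionI) (simp_all add: star_mult star_star projection_star mult.assoc PDP')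
    show "D * P $ i * D\<^sup>\<star> \<noteq> 0"
      using P1[of i] nontriv[of i] by (auto simp: nontrivial_projection_def)
    \<comment> \<open>Otherwise \<open>D\<^sup>\<star> * D\<close> would be a left inverse of
      \<open>P $ i\<close>, and an idempotent with a left inverse is 1.\<close>
    show "D * P $ i * D\<^sup>\<star> \<noteq> 1"
    proof
      assume "D * P $ i * D\<^sup>\<star> = 1"
      then have inv: "P $ i = E * E\<^sup>\<star>" using P1[of i] by simp
      have "D\<^sup>\<star> * (D * P $ i) = 1"
        unfolding inv using E E'(2) by (metis mult.assoc mult_1)
      then have "P $ i = 1"
        using projection_mult[OF PC_projection[OF P]] by (metis mult.assoc mult_1)
      then show False using nontriv[of i] by (simp add: nontrivial_projection_def)
    qed
  qed
  moreover have "(\<Sum>i\<in>UNIV. D * e i * E) = 1"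
    by (simp add: sum_e E flip: sum_distrib_left sum_distrib_right)
  moreover have "D * P $ i * D\<^sup>\<star> * (D * e i * E) = D * e i * E" for i
    using PDP'[of i "e i * E"] Pe[of i] by (metis mult.assoc)
  moreover have "D * e i * E * (D * P $ j * D\<^sup>\<star>) = (if i = j then D * P $ j * D\<^sup>\<star> else 0)" for i j
  proof -
    have "D * e i * E * (D * P $ j * D\<^sup>\<star>) = D * (e i * P $ j) * D\<^sup>\<star>"
      by (simp add: mult.assoc E')
    then show ?thesis by (simp add: eP)
  qed
  ultimately show ?thesis
    unfolding PC_iff by (intro conjI exI[of _ "\<lambda>i. D * e i * E"]) simp_all
qed

lemma unitary_imp_GL: "U \<in> unitary_group \<Longrightarrow> U \<in> GL"
  by (auto simp: unitary_group_def GL_def)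

lemma PC_unitary_conj:
  assumes "P \<in> PC" "U \<in> unitary_group"
  shows "(\<chi> i. U * P $ i * U\<^sup>\<star>) \<in> PC"
proof (rule PC_congruence[OF assms(1) unitary_imp_GL[OF assms(2)]])
  have "U\<^sup>\<star> * U = 1" using assms(2) by (simp add: unitary_group_def)
  then show "P $ i * U\<^sup>\<star> * U * P $ i = P $ i" for i
    using projection_mult[OF PC_projection[OF assms(1)]] by (simp add: mult.assoc)
qed

section \<open>Equivalence and invertible congruence\<close>

text \<open>With \<open>p\<close> the initial projection, the defect \<open>w = u - u * p\<close>
  has \<open>w\<^sup>\<star> * w = p - 2 p^2 + p^3 = 0\<close>, so the C*-identity gives
  \<open>w = 0\<close>.\<close>

lemma partial_isometry_mult_initial:
  fixes u :: "'a::cstar_algebra"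
  assumes "is_projection (u\<^sup>\<star> * u)"
  shows "u * (u\<^sup>\<star> * u) = u"
proof -
  let ?p = "u\<^sup>\<star> * u" and ?w = "u - u * (u\<^sup>\<star> * u)"
  have "?w\<^sup>\<star> * ?w = ?p - ?p * ?p - ?p * ?p + ?p * (?p * ?p)"
    by (simp add: star_diff star_mult star_star algebra_simps)
  then have "?w\<^sup>\<star> * ?w = 0"
    by (simp only: projection_mult[OF assms]) simp
  then have "norm ?w = 0"
    using cstar_identity[of ?w] by simp
  then show ?thesis by simp
qed

lemma tuple_equiv_partial_isometries:
  assumes "\<And>i. is_projection (P $ i)" "\<And>i. is_projection (P' $ i)" "P \<sim>\<^sub>M P'"
  obtains U where "\<And>i. P $ i = (U $ i)\<^sup>\<star> * U $ i" "\<And>i. P' $ i = U $ i * (U $ i)\<^sup>\<star>"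
    "\<And>i. U $ i * P $ i = U $ i" "\<And>i. P' $ i * U $ i = U $ i"
    "\<And>i. P $ i * (U $ i)\<^sup>\<star> = (U $ i)\<^sup>\<star>" "\<And>i. (U $ i)\<^sup>\<star> * P' $ i = (U $ i)\<^sup>\<star>"
proof -
  obtain U where U: "\<And>i. P $ i = (U $ i)\<^sup>\<star> * U $ i" "\<And>i. P' $ i = U $ i * (U $ i)\<^sup>\<star>"
    using assms(3) unfolding tuple_equiv_def by metis
  have UP: "U $ i * P $ i = U $ i" for i
    using partial_isometry_mult_initial assms(1)[of i] U(1)[of i] by metis
  then have PU: "P' $ i * U $ i = U $ i" for i
    by (simp add: U mult.assoc)
  have UP': "P $ i * (U $ i)\<^sup>\<star> = (U $ i)\<^sup>\<star>" for i
    using UP[of i] projection_star[OF assms(1), of i] by (metis star_mult)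
  have PU': "(U $ i)\<^sup>\<star> * P' $ i = (U $ i)\<^sup>\<star>" for i
    using PU[of i] projection_star[OF assms(2), of i] by (metis star_mult)
  show ?thesis
    using U UP PU UP' PU' by (rule that)
qed

text \<open>Inserting \<open>p i\<close> and \<open>p j\<close> on the two sides of \<open>G\<close>
  kills all cross terms. It serves with \<open>G\<close> the inverse of the sum of a complete tuple,
  and with \<open>G = 1\<close> for orthogonal tuples.\<close>

lemma sum_corners_mult:
  fixes a b p :: "'i \<Rightarrow> 'a::ring_1"
  assumes "finite I" and pGp: "\<And>i j. p i * (G * p j) = (if i = j then p i else 0)"
    and a: "\<And>i. a i * p i = a i" and b: "\<And>i. p i * b i = b i"
  shows "(\<Sum>i\<in>I. a i) * (G * (\<Sum>i\<in>I. b i)) = (\<Sum>i\<in>I. a i * b i)"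
proof -
  have "a i * (G * b j) = (if i = j then a i * b i else 0)" for i j
  proof -
    have "a i * (G * b j) = a i * (p i * (G * p j)) * b j"
      using a[of i] b[of j] by (metis mult.assoc)
    then show ?thesis by (simp add: pGp a)
  qed
  then show ?thesis
    using assms(1) by (simp add: sum_distrib_left sum_distrib_right)
qed

lemma tuple_equiv_iff_congruent:
  assumes P: "P \<in> PC" and P': "P' \<in> PC"
  shows "P \<sim>\<^sub>M P' \<longleftrightarrow> (\<exists>D \<in> GL. \<forall>i. P $ i * D * D\<^sup>\<star> * P $ i = P $ i \<and> P' $ i = D\<^sup>\<star> * P $ i * D)"
    (is "_ \<longleftrightarrow> ?C")
proof
  assume "P \<sim>\<^sub>M P'"
  then obtain U where U: "\<And>i. P $ i = (U $ i)\<^sup>\<star> * U $ i" "\<And>i. P' $ i = U $ i * (U $ i)\<^sup>\<star>"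
    and UP: "\<And>i. U $ i * P $ i = U $ i" and PU: "\<And>i. P' $ i * U $ i = U $ i"
    and UP': "\<And>i. P $ i * (U $ i)\<^sup>\<star> = (U $ i)\<^sup>\<star>" and PU': "\<And>i. (U $ i)\<^sup>\<star> * P' $ i = (U $ i)\<^sup>\<star>"
    using tuple_equiv_partial_isometries[OF PC_projection[OF P] PC_projection[OF P']] by blast
  let ?A = "\<Sum>i\<in>UNIV. P $ i" and ?A' = "\<Sum>i\<in>UNIV. P' $ i"
    and ?X = "\<Sum>i\<in>UNIV. (U $ i)\<^sup>\<star>" and ?Y = "\<Sum>i\<in>UNIV. U $ i"
  obtain G where G: "G * ?A = 1" "?A * G = 1"
    and PGP: "\<And>i j. P $ i * (G * P $ j) = (if i = j then P $ i else 0)"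
    using PC_sum_inverse[OF P] by blast
  obtain G' where G': "G' * ?A' = 1" "?A' * G' = 1"
    and PGP': "\<And>i j. P' $ i * (G' * P' $ j) = (if i = j then P' $ i else 0)"
    using PC_sum_inverse[OF P'] by blast
  \<comment> \<open>This identity and the next show that \<open>G' * ?Y\<close> is a two-sided
    inverse of \<open>G * ?X\<close>: the products reduce to \<open>G * ?A\<close> and
    \<open>G' * ?A'\<close>.\<close>
  have XY: "?X * (G' * ?Y) = ?A"
    unfolding U(1) using finite_class.finite_UNIV PGP' PU' PU by (rule sum_corners_mult)
  have YX: "?Y * (G * ?X) = ?A'"
    unfolding U(2) using finite_class.finite_UNIV PGP UP UP' by (rule sum_corners_mult)
  let ?D = "G * ?X"
  have PD: "P $ i * ?D = (U $ i)\<^sup>\<star>" for i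
  proof -
    have "P $ i * ?D = (\<Sum>j\<in>UNIV. P $ i * (G * P $ j) * (U $ j)\<^sup>\<star>)"
      by (simp add: sum_distrib_left mult.assoc UP')
    also have "\<dots> = (\<Sum>j\<in>UNIV. if i = j then (U $ i)\<^sup>\<star> else 0)"
      by (intro sum.cong refl) (simp add: PGP UP')
    finally show ?thesis by simp
  qed
  have DP: "?D\<^sup>\<star> * P $ i = U $ i" for i
    using PD[of i] projection_star[OF PC_projection[OF P, of i]] by (metis star_mult star_star)
  show ?C
  proof (intro bexI allI conjI)
    show "P $ i * ?D * ?D\<^sup>\<star> * P $ i = P $ i" for i
    proof -
      have "P $ i * ?D * ?D\<^sup>\<star> * P $ i = P $ i * ?D * (?D\<^sup>\<star> * P $ i)"
        by (rule mult.assoc)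
      also have "\<dots> = P $ i"
        unfolding PD DP by (rule U(1)[symmetric])
      finally show ?thesis .
    qed
    show "P' $ i = ?D\<^sup>\<star> * P $ i * ?D" for i
    proof -
      have "?D\<^sup>\<star> * P $ i * ?D = ?D\<^sup>\<star> * (P $ i * P $ i) * ?D"
        using projection_mult[OF PC_projection[OF P]] by simp
      also have "\<dots> = (?D\<^sup>\<star> * P $ i) * (P $ i * ?D)"
        by (simp only: mult.assoc)
      also have "\<dots> = P' $ i"
        unfolding PD DP by (rule U(2)[symmetric])
      finally show ?thesis by (rule sym)
    qed
    have "?D * (G' * ?Y) = 1"
      by (simp only: mult.assoc XY G)
    moreover have "(G' * ?Y) * ?D = 1"
      by (simp only: mult.assoc YX G')
    ultimately show "?D \<in> GL"
      unfolding GL_def by blast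
  qed
next
  assume ?C
  then obtain D where D: "\<And>i. P $ i * D * D\<^sup>\<star> * P $ i = P $ i" "\<And>i. P' $ i = D\<^sup>\<star> * P $ i * D"
    by blast
  show "P \<sim>\<^sub>M P'"
    unfolding tuple_equiv_def
  proof (intro exI[of _ "\<chi> i. D\<^sup>\<star> * P $ i"] allI conjI; unfold vec_lambda_beta)
    fix i
    have star: "(D\<^sup>\<star> * P $ i)\<^sup>\<star> = P $ i * D"
      using projection_star[OF PC_projection[OF P, of i]] by (simp add: star_mult star_star)
    show "P $ i = (D\<^sup>\<star> * P $ i)\<^sup>\<star> * (D\<^sup>\<star> * P $ i)"
      unfolding star using D(1)[of i] by (simp only: mult.assoc)
    show "P' $ i = D\<^sup>\<star> * P $ i * (D\<^sup>\<star> * P $ i)\<^sup>\<star>"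
      unfolding star using D(2)[of i] projection_mult_left[OF PC_projection[OF P]]
      by (simp only: mult.assoc)
  qed
qed

section \<open>Homotopy\<close>

text \<open>Makes symmetry and transitivity of path components available for homotopy.\<close>

lemma tuple_homotopic_iff_path_component: "P \<sim>\<^sub>h P' \<longleftrightarrow> path_component PC P P'"
  by (simp add: tuple_homotopic_def path_defs)

lemma tuple_homotopic_imp_equiv:
  assumes "P \<sim>\<^sub>h P'"
  shows "P \<sim>\<^sub>M P'"
proof -
  obtain F where F: "continuous_on {0..1 :: real} F" "F ` {0..1} \<subseteq> PC" "F 0 = P" "F 1 = P'"
    using assms unfolding tuple_homotopic_def by blast
  have proj: "is_projection (F t $ i)" if "t \<in> {0..1}" for t i
    using F(2) that by (intro PC_projection) blast
  have "\<forall>i. mvn_equiv (F 0 $ i) (F 1 $ i)"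
  proof (rule connected_equivalence_relation[where S = "{0..1 :: real}"])
    fix s t u :: real
    assume "\<forall>i. mvn_equiv (F s $ i) (F t $ i)" "\<forall>i. mvn_equiv (F t $ i) (F u $ i)"
      and "s \<in> {0..1}" "u \<in> {0..1}"
    then show "\<forall>i. mvn_equiv (F s $ i) (F u $ i)"
      using mvn_equiv_trans proj by blast
  next
    fix s :: real
    assume s: "s \<in> {0..1}"
    \<comment> \<open>Entries are no farther apart than the tuples, so radius 1 matches the bound
      for close projections.\<close>
    let ?T = "{0..1} \<inter> F -` ball (F s) 1"
    have "openin (top_of_set {0..1}) ?T"
      using F(1) by (rule continuous_openin_preimage_gen) simp
    moreover have "mvn_equiv (F s $ i) (F t $ i)" if "t \<in> ?T" for t i
    proof (rule mvn_equiv_close_projections)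
      have "dist (F s $ i) (F t $ i) \<le> dist (F s) (F t)"
        by (rule dist_vec_nth_le)
      then show "norm (F s $ i - F t $ i) < 1"
        using that by (simp add: dist_norm)
    qed (use proj s that in auto)
    ultimately show "\<exists>T. openin (top_of_set {0..1}) T \<and> s \<in> T \<and> (\<forall>t\<in>T. \<forall>i. mvn_equiv (F s $ i) (F t $ i))"
      using s by (intro exI[of _ ?T]) auto
  qed (auto intro: mvn_equiv_sym)
  then show ?thesis
    by (simp add: tuple_equiv_iff_mvn F)
qed

lemma tuple_homotopic_unitary_conj:
  assumes "P \<sim>\<^sub>h P'" and U: "U \<in> unitary_group"
  shows "(\<chi> i. U * P $ i * U\<^sup>\<star>) \<sim>\<^sub>h (\<chi> i. U * P' $ i * U\<^sup>\<star>)"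
proof -
  obtain F where F: "continuous_on {0..1 :: real} F" "F ` {0..1} \<subseteq> PC" "F 0 = P" "F 1 = P'"
    using assms(1) unfolding tuple_homotopic_def by blast
  show ?thesis
    unfolding tuple_homotopic_def
  proof (intro exI[of _ "\<lambda>t. \<chi> i. U * F t $ i * U\<^sup>\<star>"] conjI)
    show "continuous_on {0..1} (\<lambda>t. \<chi> i. U * F t $ i * U\<^sup>\<star>)"
      by (intro continuous_intros F(1))
    show "(\<lambda>t. \<chi> i. U * F t $ i * U\<^sup>\<star>) ` {0..1} \<subseteq> PC"
      using F(2) PC_unitary_conj[OF _ U] by blast
  qed (simp_all add: F)
qed

section \<open>Orthogonal complete tuples\<close>

definition orthogonal_tuple :: "'a::cstar_algebra ^ 'n::finite \<Rightarrow> bool" where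
  "orthogonal_tuple Q \<longleftrightarrow> (\<forall>i j. i \<noteq> j \<longrightarrow> Q $ i * Q $ j = 0) \<and> (\<Sum>i\<in>UNIV. Q $ i) = 1"

lemma orthogonal_tuple_equiv_imp_unitary:
  assumes Q: "Q \<in> PC" "orthogonal_tuple Q" and Q': "Q' \<in> PC" "orthogonal_tuple Q'"
    and equiv: "Q \<sim>\<^sub>M Q'"
  obtains V where "V \<in> unitary_group" "\<And>i. V * Q $ i * V\<^sup>\<star> = Q' $ i"
proof -
  obtain U where U: "\<And>i. Q $ i = (U $ i)\<^sup>\<star> * U $ i" "\<And>i. Q' $ i = U $ i * (U $ i)\<^sup>\<star>"
    and UQ: "\<And>i. U $ i * Q $ i = U $ i" and QU: "\<And>i. Q' $ i * U $ i = U $ i"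
    and UQ': "\<And>i. Q $ i * (U $ i)\<^sup>\<star> = (U $ i)\<^sup>\<star>" and QU': "\<And>i. (U $ i)\<^sup>\<star> * Q' $ i = (U $ i)\<^sup>\<star>"
    using tuple_equiv_partial_isometries[OF PC_projection[OF Q(1)] PC_projection[OF Q'(1)] equiv]
    by blast
  \<comment> \<open>The factor 1 takes the place of \<open>G\<close> in
    \<open>sum_corners_mult\<close>.\<close>
  have QQ: "Q $ i * (1 * Q $ j) = (if i = j then Q $ i else 0)" for i j
    using Q(2) projection_mult[OF PC_projection[OF Q(1)]] by (simp add: orthogonal_tuple_def)
  have QQ': "Q' $ i * (1 * Q' $ j) = (if i = j then Q' $ i else 0)" for i j
    using Q'(2) projection_mult[OF PC_projection[OF Q'(1)]] by (simp add: orthogonal_tuple_def)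
  define V where "V = (\<Sum>i\<in>UNIV. U $ i)"
  have V': "V\<^sup>\<star> = (\<Sum>i\<in>UNIV. (U $ i)\<^sup>\<star>)"
    by (simp add: V_def star_sum)
  have "V\<^sup>\<star> * (1 * V) = (\<Sum>i\<in>UNIV. Q $ i)"
    unfolding V' unfolding V_def U(1) using finite_class.finite_UNIV QQ' QU' QU by (rule sum_corners_mult)
  moreover have "V * (1 * V\<^sup>\<star>) = (\<Sum>i\<in>UNIV. Q' $ i)"
    unfolding V' unfolding V_def U(2) using finite_class.finite_UNIV QQ UQ UQ' by (rule sum_corners_mult)
  ultimately have "V \<in> unitary_group"
    using Q(2) Q'(2) by (simp add: unitary_group_def orthogonal_tuple_def)
  moreover have "V * Q $ i * V\<^sup>\<star> = Q' $ i" for i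
  proof -
    \<comment> \<open>Writing \<open>U $ j\<close> as \<open>U $ j * Q $ j\<close> and using
      orthogonality, \<open>V\<close> acts on \<open>Q $ i\<close> as \<open>U $ i\<close>.\<close>
    have "U $ j * Q $ i = (if j = i then U $ j else 0)" for j
      using QQ[of j i] UQ[of j] by (metis mult.assoc mult.left_neutral mult_zero_right)
    then have VQ: "V * Q $ i = U $ i"
      by (simp add: V_def sum_distrib_right)
    have "V * Q $ i * V\<^sup>\<star> = V * (Q $ i * Q $ i) * V\<^sup>\<star>"
      by (simp add: projection_mult[OF PC_projection[OF Q(1)]])
    also have "\<dots> = (V * Q $ i) * (V * Q $ i)\<^sup>\<star>"
      by (simp add: star_mult projection_star[OF PC_projection[OF Q(1)]] mult.assoc)
    also have "\<dots> = Q' $ i"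
      by (simp add: VQ U(2))
    finally show ?thesis .
  qed
  ultimately show ?thesis by (rule that)
qed

text \<open>Conjugating with \<open>A^(-1/2)\<close>, where \<open>A\<close> is the sum of the \<open>P $ i\<close>, makes a complete tuple
  orthogonal. The path runs through \<open>D t = (((1 - t) A + t) / A)^(1/2)\<close>: its square is
  \<open>(1 - t) + t A^(-1)\<close>, whose compression to every \<open>P $ i\<close> is \<open>P $ i\<close>. The element \<open>z t\<close> below is
  \<open>1 - ((1 - t) A + t) / n\<close>, which lies in the unit ball because \<open>n - A\<close> is a sum of \<open>n\<close>
  projections; no positivity theory is needed, since the binomial series of \<open>sqrt (1 - z)\<close> still
  converges absolutely on its boundary.\<close>
lemma PC_homotopic_orthogonal:
  fixes P :: "'a::cstar_algebra ^ 'n::finite"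
  assumes P: "P \<in> PC"
  obtains Q where "Q \<in> PC" "P \<sim>\<^sub>h Q" "orthogonal_tuple Q"
proof -
  note Pp = projection_mult[OF PC_projection[OF P]] and Ps = projection_star[OF PC_projection[OF P]]
  define n where "n = real CARD('n)"
  have n: "n \<ge> 1"
    unfolding n_def by (simp add: Suc_leI)
  define A where "A = (\<Sum>i\<in>UNIV. P $ i)"
  obtain G where G: "G * A = 1" "A * G = 1"
    and PGP: "\<And>i j. P $ i * (G * P $ j) = (if i = j then P $ i else 0)"
    using PC_sum_inverse[OF P] unfolding A_def by blast
  define y where "y = 1 - (1 / n) *\<^sub>R A"
  define z where "z t = (1 - t) *\<^sub>R y + (t * (1 - 1 / n)) *\<^sub>R 1" for t
  have As: "A\<^sup>\<star> = A"
    by (simp add: A_def star_sum Ps)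
  have y1: "norm y \<le> 1"
  proof -
    have "n *\<^sub>R y = n *\<^sub>R 1 - A"
      using n by (simp add: y_def scaleR_diff_right)
    also have "\<dots> = (\<Sum>i\<in>UNIV. 1 - P $ i)"
      by (simp add: A_def sum_subtractf n_def scaleR_conv_of_real)
    also have "norm \<dots> \<le> (\<Sum>i\<in>(UNIV :: 'n set). 1)"
      by (intro sum_norm_le norm_projection_le projection_complement PC_projection P)
    finally show ?thesis
      using n by (simp add: n_def)
  qed
  have ys: "y\<^sup>\<star> = y" and zs: "(z t)\<^sup>\<star> = z t" for t
    by (simp_all add: y_def z_def star_diff star_add star_scaleR As)
  have norm_z: "norm (z t) \<le> (1 - t) + t * (1 - 1 / n)" if "t \<in> {0..1}" for t
  proof -
    have "norm (z t) \<le> norm ((1 - t) *\<^sub>R y) + norm ((t * (1 - 1 / n)) *\<^sub>R (1 :: 'a))"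
      unfolding z_def by (rule norm_triangle_ineq)
    also have "\<dots> = (1 - t) * norm y + t * (1 - 1 / n)"
      using that n by (simp add: abs_mult)
    also have "\<dots> \<le> (1 - t) * 1 + t * (1 - 1 / n)"
      using that y1 by (intro add_right_mono mult_left_mono) auto
    finally show ?thesis by simp
  qed
  have z1: "norm (z t) \<le> 1" if "t \<in> {0..1}" for t
    using norm_z[OF that] that n by (simp add: algebra_simps) (smt (verit) divide_nonneg_nonneg)
  have g: "(1 - y) * (n *\<^sub>R G) = 1" "(n *\<^sub>R G) * (1 - y) = 1"
    using n G by (simp_all add: y_def)
  \<comment> \<open>Since \<open>1 - y = A / n\<close>, this \<open>h\<close> is (A / n)^(-1/2). As
    \<open>z 0 = y\<close>, the element \<open>D 0\<close> defined from it is 1.\<close>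
  obtain h where h: "h\<^sup>\<star> = h" "h * h = n *\<^sub>R G" "sqrt_one_minus y * h = 1" "h * sqrt_one_minus y = 1"
    and hc: "\<And>w. w * y = y * w \<Longrightarrow> w * h = h * w"
    using inverse_sqrt_one_minus[OF y1 ys g] by metis
  define D where "D t = sqrt_one_minus (z t) * h" for t
  have zc: "w * z t = z t * w" if "w * y = y * w" for w t
    using that by (simp add: z_def algebra_simps)
  have sc: "w * sqrt_one_minus (z t) = sqrt_one_minus (z t) * w" if "t \<in> {0..1}" "w * y = y * w" for w t
    using z1[OF that(1)] zc[OF that(2)] by (rule sqrt_one_minus_commute)
  have Dc: "w * D t = D t * w" if "t \<in> {0..1}" "w * y = y * w" for w t
    unfolding D_def using sc[OF that] hc[OF that(2)] by (metis mult.assoc)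
  have hy: "h * y = y * h"
    using hc[of y] by simp
  have Ds: "(D t)\<^sup>\<star> = D t" if "t \<in> {0..1}" for t
    using sc[OF that hy] by (simp add: D_def star_mult star_sqrt_one_minus z1[OF that] zs h(1))
  have DD: "D t * D t = (1 - t) *\<^sub>R 1 + t *\<^sub>R G" if "t \<in> {0..1}" for t
  proof -
    have "D t * D t = (sqrt_one_minus (z t) * sqrt_one_minus (z t)) * (h * h)"
      unfolding D_def using sc[OF that hy] by (metis mult.assoc)
    also have "\<dots> = (1 - z t) * (n *\<^sub>R G)"
      by (simp only: sqrt_one_minus_square[OF z1[OF that]] h(2))
    also have "1 - z t = (1 - t) *\<^sub>R (1 - y) + (t / n) *\<^sub>R 1"
      by (simp add: z_def algebra_simps)
    also have "\<dots> * (n *\<^sub>R G) = (1 - t) *\<^sub>R ((1 - y) * (n *\<^sub>R G)) + t *\<^sub>R G"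
      using n by (simp add: distrib_right scaleR_add_right mult.commute)
    finally show ?thesis by (simp only: g(1))
  qed
  have D_GL: "D t \<in> GL" if t: "t \<in> {0..1}" for t
  proof -
    \<comment> \<open>At \<open>t = 0\<close> the norm of \<open>z t\<close> may be 1, and the
      inverse comes from that of \<open>A\<close>; for \<open>t > 0\<close> the norm is at most
      \<open>1 - t / n\<close>, so a Neumann series applies.\<close>
    obtain g where g': "(1 - z t) * g = 1" "g * (1 - z t) = 1"
    proof (cases "t = 0")
      case True
      then have "z t = y" by (simp add: z_def)
      then show ?thesis using that[of "n *\<^sub>R G"] g by simp
    next
      case False
      have "norm (z t) \<le> 1 - t / n"
        using norm_z[OF t] by (simp add: algebra_simps)
      moreover have "t / n > 0"
        using False t n by simp
      ultimately have "norm (z t) < 1" by linarith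
      then show ?thesis using that by (rule neumann_inverse)
    qed
    obtain k where k: "sqrt_one_minus (z t) * k = 1" "k * sqrt_one_minus (z t) = 1"
      using inverse_sqrt_one_minus[OF z1[OF t] zs g'] by metis
    have "D t * (sqrt_one_minus y * k) = 1" "(sqrt_one_minus y * k) * D t = 1"
      unfolding D_def using k h(3,4) by (metis mult.assoc mult.left_neutral)+
    then show ?thesis unfolding GL_def by blast
  qed
  define F where "F t = (\<chi> i. D t * P $ i * (D t)\<^sup>\<star>)" for t
  have F_PC: "F t \<in> PC" if "t \<in> {0..1}" for t
    unfolding F_def
  proof (rule PC_congruence[OF P D_GL[OF that]])
    fix i
    have "P $ i * (D t)\<^sup>\<star> * D t * P $ i = P $ i * (D t * D t) * P $ i"
      by (simp add: Ds[OF that] mult.assoc)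
    also have "\<dots> = (1 - t) *\<^sub>R (P $ i * P $ i) + t *\<^sub>R (P $ i * (G * P $ i))"
      unfolding DD[OF that] by (simp add: algebra_simps)
    finally show "P $ i * (D t)\<^sup>\<star> * D t * P $ i = P $ i"
      by (simp add: Pp PGP flip: scaleR_add_left)
  qed
  have "continuous_on {0..1} z"
    unfolding z_def by (intro continuous_intros)
  then have "continuous_on {0..1} (\<lambda>t. sqrt_one_minus (z t))"
    by (rule continuous_on_compose2[OF continuous_on_sqrt_one_minus]) (auto simp: z1)
  then have "continuous_on {0..1} D"
    unfolding D_def by (intro continuous_intros)
  then have "continuous_on {0..1} F"
    unfolding F_def
    by (intro continuous_intros bounded_linear.continuous_on[OF bounded_linear_star])
  moreover have "F 0 = P"
    by (simp add: F_def D_def z_def h(3) vec_eq_iff)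
  ultimately have "P \<sim>\<^sub>h F 1"
    unfolding tuple_homotopic_def using F_PC by (intro exI[of _ F]) auto
  moreover have "orthogonal_tuple (F 1)"
    unfolding orthogonal_tuple_def
  proof (intro conjI allI impI)
    have D1: "D 1 * D 1 = G" "(D 1)\<^sup>\<star> = D 1"
      using DD[of 1] Ds[of 1] by simp_all
    show "F 1 $ i * F 1 $ j = 0" if "i \<noteq> j" for i j
    proof -
      have "F 1 $ i * F 1 $ j = D 1 * (P $ i * ((D 1 * D 1) * P $ j)) * D 1"
        by (simp add: F_def D1(2) mult.assoc)
      then show ?thesis using that by (simp add: D1(1) PGP)
    qed
    have "(\<Sum>i\<in>UNIV. F 1 $ i) = D 1 * A * D 1"
      by (simp add: F_def D1(2) A_def sum_distrib_left sum_distrib_right)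
    \<comment> \<open>\<open>A\<close> commutes with \<open>y\<close>, hence with
      \<open>D 1\<close>, so the sum of the conjugated projections becomes
      \<open>A * G = 1\<close>.\<close>
    moreover have "A * D 1 = D 1 * A"
      using Dc[of 1 A] by (simp add: y_def algebra_simps)
    then have "D 1 * A * D 1 = A * (D 1 * D 1)"
      by (metis mult.assoc)
    ultimately show "(\<Sum>i\<in>UNIV. F 1 $ i) = 1"
      by (simp add: D1(1) G)
  qed
  ultimately show ?thesis
    using F_PC[of 1] that by simp
qed

theorem theorem4p4:
  fixes P P' :: "'a::cstar_algebra ^ 'n::finite"
  assumes "CARD('n) \<ge> 2"
    and "P \<in> PC" and "P' \<in> PC"
  shows "(P \<sim>\<^sub>M P' \<longleftrightarrow>
            (\<exists>D \<in> GL. \<forall>i. P $ i * D * D\<^sup>\<star> * P $ i = P $ i \<and> P' $ i = D\<^sup>\<star> * P $ i * D))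
       \<and> ((\<exists>D \<in> GL. \<forall>i. P $ i * D * D\<^sup>\<star> * P $ i = P $ i \<and> P' $ i = D\<^sup>\<star> * P $ i * D) \<longleftrightarrow>
            (\<exists>S \<in> PC. P \<sim>\<^sub>u S \<and> S \<sim>\<^sub>h P'))"
proof -
  have trans: "X \<sim>\<^sub>M Z" if "X \<in> PC" "Z \<in> PC" "X \<sim>\<^sub>M Y" "Y \<sim>\<^sub>M Z" for X Y Z :: "'a ^ 'n"
    using that mvn_equiv_trans PC_projection unfolding tuple_equiv_iff_mvn by metis
  have "P \<sim>\<^sub>M P' \<longleftrightarrow> (\<exists>S \<in> PC. P \<sim>\<^sub>u S \<and> S \<sim>\<^sub>h P')"
  proof
    assume equiv: "P \<sim>\<^sub>M P'"
    obtain Q where Q: "Q \<in> PC" "P \<sim>\<^sub>h Q" "orthogonal_tuple Q"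
      using PC_homotopic_orthogonal[OF assms(2)] .
    obtain Q' where Q': "Q' \<in> PC" "P' \<sim>\<^sub>h Q'" "orthogonal_tuple Q'"
      using PC_homotopic_orthogonal[OF assms(3)] .
    have "Q \<sim>\<^sub>M P"
      using tuple_homotopic_imp_equiv[OF Q(2)] mvn_equiv_sym by (auto simp: tuple_equiv_iff_mvn)
    then have "Q \<sim>\<^sub>M Q'"
      using trans[OF Q(1) assms(3) _ equiv] trans[OF Q(1) Q'(1)] tuple_homotopic_imp_equiv[OF Q'(2)]
      by blast
    then obtain V where V: "V \<in> unitary_group" "\<And>i. V * Q $ i * V\<^sup>\<star> = Q' $ i"
      using orthogonal_tuple_equiv_imp_unitary Q Q' by metis
    \<comment> \<open>Conjugating the homotopy from \<open>P\<close> to \<open>Q\<close> by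
      \<open>V\<close> leads from \<open>?S\<close> to \<open>Q'\<close>; the reversed homotopy from
      \<open>P'\<close> to \<open>Q'\<close> completes the path.\<close>
    let ?S = "\<chi> i. V * P $ i * V\<^sup>\<star>"
    have "?S \<sim>\<^sub>h Q'"
      using tuple_homotopic_unitary_conj[OF Q(2) V(1)] by (simp add: V(2))
    then have "?S \<sim>\<^sub>h P'"
      using Q'(2) path_component_sym path_component_trans
      unfolding tuple_homotopic_iff_path_component by blast
    moreover have "P \<sim>\<^sub>u ?S"
      unfolding tuple_unitary_equiv_def using V(1) by (intro bexI[of _ V]) simp_all
    ultimately show "\<exists>S \<in> PC. P \<sim>\<^sub>u S \<and> S \<sim>\<^sub>h P'"
      using PC_unitary_conj[OF assms(2) V(1)] by blast
  next
    assume "\<exists>S \<in> PC. P \<sim>\<^sub>u S \<and> S \<sim>\<^sub>h P'"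
    then obtain S where S: "P \<sim>\<^sub>u S" "S \<sim>\<^sub>h P'" by blast
    have "P \<sim>\<^sub>M S"
      using S(1) mvn_equiv_unitary_conj PC_projection[OF assms(2)]
      unfolding tuple_equiv_iff_mvn tuple_unitary_equiv_def by metis
    then show "P \<sim>\<^sub>M P'"
      using trans[OF assms(2,3)] tuple_homotopic_imp_equiv[OF S(2)] by blast
  qed
  then show ?thesis
    using tuple_equiv_iff_congruent[OF assms(2,3)] by blast
qed

end
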